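(* Let $k$ be a field of characteristic $0$ and let $X=\operatorname{Spec} k[y]/(y^2)\subset\mathbb{A}^1_k$ be the double point. Define a sequence $(A_d)_{d\geq 1}$ in $k[[t]]$ by $A_1=A_2=1$ and $$A_d=A_{d-1}+t^{d-2}A_{d-2}\qquad\text{for } d\geq 3.$$ Then $(A_d)_d$ converges in the $(t)$-adic topology and $\operatorname{HP}_{J_\infty^0(X)}(t)=\lim_{d\to\infty}A_d$, where $J_\infty^0(X)$ is the focussed arc algebra of $X$ at the origin, graded by weight.
   Context: The focussed arc algebra at the origin of $X=\{y^2=0\}\subset\mathbb{A}^1_k$ is $J_\infty^0(X)=k[y_1,y_2,\ldots]/(f_1,f_2,\ldots)$, where $k[y_1,y_2,\ldots]$ is the polynomial ring in countably many variables and $f_\ell$ is the coefficient of $t^\ell$ in $(y_1t+y_2t^2+y_3t^3+\cdots)^2$. The ring $k[y_1,y_2,\ldots]$ is graded by giving $y_i$ weight $i$; each $f_\ell$ is homogeneous of weight $\ell$, so $J_\infty^0(X)$ is graded. For a graded $k$-algebra $A=\bigoplus_{j\geq 0}A_j$ with finite-dimensional pieces, $\operatorname{HP}_A(t)=\sum_{j\geq 0}\dim_k(A_j)\,t^j$, regarded here as an element of $k[[t]]$. *)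

theory Defs
  imports
    "HOL-Library.Poly_Mapping"
    "HOL-Computational_Algebra.Formal_Power_Series"
begin

section \<open>Polynomials in \<open>y\<^sub>1, y\<^sub>2, \<dots>\<close> and their weights\<close>

text \<open>
  A monomial is a finitely supported exponent function and a polynomial is a finitely supported
  function from monomials to coefficients. The index set of the variables is \<^typ>\<open>nat\<close>, with a
  shift: index \<open>n\<close> stands for \<open>y\<^bsub>n+1\<^esub>\<close>, so that there is no variable \<open>y\<^sub>0\<close>.
\<close>

type_synonym arc_monomial = "nat \<Rightarrow>\<^sub>0 nat"
type_synonym 'a arc_poly = "arc_monomial \<Rightarrow>\<^sub>0 'a"

definition arc_var :: "nat \<Rightarrow> 'a::comm_ring_1 arc_poly" where
  "arc_var n = Poly_Mapping.single (Poly_Mapping.single n 1) 1"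

definition arc_const :: "'a::comm_ring_1 \<Rightarrow> 'a arc_poly" where
  "arc_const c = Poly_Mapping.single 0 c"

text \<open>The variable with index \<open>n\<close> is \<open>y\<^bsub>n+1\<^esub>\<close> and therefore has weight \<open>n + 1\<close>.\<close>

definition weight :: "arc_monomial \<Rightarrow> nat" where
  "weight m = (\<Sum>n\<in>Poly_Mapping.keys m. (n + 1) * Poly_Mapping.lookup m n)"

definition homogeneous_of_weight :: "nat \<Rightarrow> 'a::comm_ring_1 arc_poly set" where
  "homogeneous_of_weight j = {p. \<forall>m\<in>Poly_Mapping.keys p. weight m = j}"

section \<open>The focussed arc algebra of the double point\<close>

text \<open>The universal arc \<open>y\<^sub>1 t + y\<^sub>2 t\<^sup>2 + y\<^sub>3 t\<^sup>3 + \<dots>\<close> through the origin.\<close>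

definition generic_arc :: "'a::comm_ring_1 arc_poly fps" where
  "generic_arc = fps_X * Abs_fps arc_var"

definition arc_equation :: "nat \<Rightarrow> 'a::comm_ring_1 arc_poly" where
  "arc_equation l = fps_nth (generic_arc ^ 2) l"

lemma module_mult: "module ((*) :: 'b::comm_ring_1 \<Rightarrow> 'b \<Rightarrow> 'b)"
  by unfold_locales (simp_all add: algebra_simps)

text \<open>An ideal of a commutative ring is a submodule of the ring over itself.\<close>

definition ideal_generated_by :: "'b::comm_ring_1 set \<Rightarrow> 'b set" where
  "ideal_generated_by S = module.span (*) S"

definition arc_ideal :: "'a::comm_ring_1 arc_poly set" where
  "arc_ideal = ideal_generated_by (arc_equation ` {1..})"

definition arc_cong :: "'a::comm_ring_1 arc_poly \<Rightarrow> 'a arc_poly \<Rightarrow> bool" where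
  "arc_cong p q \<longleftrightarrow> p - q \<in> arc_ideal"

lemma arc_ideal_0: "0 \<in> arc_ideal"
  unfolding arc_ideal_def ideal_generated_by_def by (rule module.span_zero[OF module_mult])

lemma arc_ideal_add: "p \<in> arc_ideal \<Longrightarrow> q \<in> arc_ideal \<Longrightarrow> p + q \<in> arc_ideal"
  unfolding arc_ideal_def ideal_generated_by_def by (rule module.span_add[OF module_mult])

lemma arc_ideal_mult: "q \<in> arc_ideal \<Longrightarrow> p * q \<in> arc_ideal"
  unfolding arc_ideal_def ideal_generated_by_def by (rule module.span_scale[OF module_mult])

lemma arc_ideal_uminus: "p \<in> arc_ideal \<Longrightarrow> - p \<in> arc_ideal"
  using arc_ideal_mult[of p "- 1"] by simp

lemma arc_cong_refl: "arc_cong p p"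
  by (simp add: arc_cong_def arc_ideal_0)

lemma arc_cong_sym: "arc_cong p q \<Longrightarrow> arc_cong q p"
  unfolding arc_cong_def using arc_ideal_uminus[of "p - q"] by simp

lemma arc_cong_trans: "arc_cong p q \<Longrightarrow> arc_cong q r \<Longrightarrow> arc_cong p r"
  unfolding arc_cong_def using arc_ideal_add[of "p - q" "q - r"] by simp

lemma arc_cong_add: "arc_cong p p' \<Longrightarrow> arc_cong q q' \<Longrightarrow> arc_cong (p + q) (p' + q')"
  unfolding arc_cong_def using arc_ideal_add[of "p - p'" "q - q'"] by (simp add: algebra_simps)

lemma arc_cong_uminus: "arc_cong p p' \<Longrightarrow> arc_cong (- p) (- p')"
  unfolding arc_cong_def using arc_ideal_uminus[of "p - p'"] by simp

lemma arc_cong_mult: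
  assumes "arc_cong p p'" "arc_cong q q'"
  shows "arc_cong (p * q) (p' * q')"
proof -
  have "q * (p - p') + p' * (q - q') \<in> arc_ideal"
    using assms unfolding arc_cong_def by (intro arc_ideal_add arc_ideal_mult)
  then show ?thesis
    unfolding arc_cong_def by (simp add: algebra_simps)
qed

lemma lookup_mult_0_eq_0:
  fixes p q :: "'a::comm_ring_1 arc_poly"
  assumes "Poly_Mapping.lookup q 0 = 0"
  shows "Poly_Mapping.lookup (p * q) 0 = 0"
proof (rule ccontr)
  assume "Poly_Mapping.lookup (p * q) 0 \<noteq> 0"
  then have "0 \<in> Poly_Mapping.keys (p * q)"
    by (simp add: in_keys_iff)
  then obtain a b where b: "b \<in> Poly_Mapping.keys q" and ab: "0 = a + b"
    using keys_mult[of p q] by blast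
  have "Poly_Mapping.lookup b i = 0" for i
    using arg_cong[OF ab, of "\<lambda>m. Poly_Mapping.lookup m i"] by (simp add: lookup_add)
  then have "b = 0"
    by (intro poly_mapping_eqI) simp
  with b assms show False
    by (simp add: in_keys_iff)
qed

lemma lookup_generic_arc_0: "Poly_Mapping.lookup (fps_nth generic_arc i) 0 = 0"
proof (cases i)
  case (Suc n)
  have "Poly_Mapping.single n (1::nat) \<noteq> 0"
    by (metis lookup_single_eq lookup_zero zero_neq_one)
  then show ?thesis
    using Suc by (simp add: generic_arc_def arc_var_def lookup_single)
qed (simp add: generic_arc_def)

lemma lookup_arc_equation_0: "Poly_Mapping.lookup (arc_equation l) 0 = 0"
  by (auto simp: arc_equation_def power2_eq_square fps_mult_nth lookup_sum
      intro!: sum.neutral lookup_mult_0_eq_0 lookup_generic_arc_0)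

lemma lookup_arc_ideal_0:
  assumes "p \<in> arc_ideal"
  shows "Poly_Mapping.lookup p 0 = 0"
proof -
  have "p \<in> module.span (*) (arc_equation ` {1..})"
    using assms unfolding arc_ideal_def ideal_generated_by_def .
  then show ?thesis
    by (rule module.span_induct_alt[OF module_mult])
      (auto simp: lookup_add intro!: lookup_mult_0_eq_0 lookup_arc_equation_0)
qed

lemma one_notin_arc_ideal: "1 \<notin> arc_ideal"
  using lookup_arc_ideal_0[of 1] by (auto simp: lookup_one)

quotient_type (overloaded) 'a arc_algebra = "'a::comm_ring_1 arc_poly" / arc_cong
  morphisms arc_rep arc_class
  by (intro equivpI reflpI sympI transpI) (auto intro: arc_cong_refl arc_cong_sym arc_cong_trans)

instantiation arc_algebra :: (comm_ring_1) comm_ring_1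
begin

lift_definition zero_arc_algebra :: "'a arc_algebra" is 0 .

lift_definition one_arc_algebra :: "'a arc_algebra" is 1 .

lift_definition plus_arc_algebra :: "'a arc_algebra \<Rightarrow> 'a arc_algebra \<Rightarrow> 'a arc_algebra" is "(+)"
  by (rule arc_cong_add)

lift_definition uminus_arc_algebra :: "'a arc_algebra \<Rightarrow> 'a arc_algebra" is uminus
  by (rule arc_cong_uminus)

lift_definition minus_arc_algebra :: "'a arc_algebra \<Rightarrow> 'a arc_algebra \<Rightarrow> 'a arc_algebra" is "(-)"
  unfolding diff_conv_add_uminus by (intro arc_cong_add arc_cong_uminus)

lift_definition times_arc_algebra :: "'a arc_algebra \<Rightarrow> 'a arc_algebra \<Rightarrow> 'a arc_algebra" is "(*)"
  by (rule arc_cong_mult)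

instance
proof
  fix x y z :: "'a arc_algebra"
  show "x * y * z = x * (y * z)"
    by transfer (simp add: mult.assoc arc_cong_refl)
  show "x * y = y * x"
    by transfer (simp add: mult.commute arc_cong_refl)
  show "1 * x = x"
    by transfer (simp add: arc_cong_refl)
  show "x + y + z = x + (y + z)"
    by transfer (simp add: add.assoc arc_cong_refl)
  show "x + y = y + x"
    by transfer (simp add: add.commute arc_cong_refl)
  show "0 + x = x"
    by transfer (simp add: arc_cong_refl)
  show "- x + x = 0"
    by transfer (simp add: arc_cong_refl)
  show "x - y = x + - y"
    by transfer (simp add: arc_cong_refl)
  show "(x + y) * z = x * z + y * z"
    by transfer (simp add: distrib_right arc_cong_refl)
  have "\<not> arc_cong (0 :: 'a arc_poly) 1"
    using one_notin_arc_ideal arc_ideal_uminus[of "- 1"] by (auto simp: arc_cong_def)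
  then show "(0 :: 'a arc_algebra) \<noteq> 1"
    by transfer
qed

end

lift_definition arc_scale :: "'a::comm_ring_1 \<Rightarrow> 'a arc_algebra \<Rightarrow> 'a arc_algebra"
  is "\<lambda>c p. arc_const c * p"
  by (rule arc_cong_mult[OF arc_cong_refl])

lemma arc_const_simps:
  "arc_const (a + b) = arc_const a + arc_const b"
  "arc_const (a * b) = arc_const a * arc_const b"
  "arc_const 1 = 1"
  by (simp_all add: arc_const_def single_add mult_single)

interpretation arc_algebra: vector_space "arc_scale :: 'a::field \<Rightarrow> 'a arc_algebra \<Rightarrow> 'a arc_algebra"
  by unfold_locales (transfer; simp add: arc_const_simps algebra_simps arc_cong_refl)+

definition arc_piece :: "nat \<Rightarrow> 'a::comm_ring_1 arc_algebra set" where
  "arc_piece j = arc_class ` homogeneous_of_weight j"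

section \<open>Hilbert--Poincare series\<close>

text \<open>
  The vector space is given by its scalar multiplication and \<open>A j\<close> is its graded piece of degree
  \<open>j\<close>. The dimension of the library is \<open>0\<close> for infinite-dimensional spaces, so this is meaningful
  only if all \<open>A j\<close> are finite-dimensional; see \<open>arc_piece_finite_dim\<close> below.
\<close>

definition hilbert_poincare ::
    "('a::field \<Rightarrow> 'v::ab_group_add \<Rightarrow> 'v) \<Rightarrow> (nat \<Rightarrow> 'v set) \<Rightarrow> 'a fps" where
  "hilbert_poincare scale A = Abs_fps (\<lambda>j. of_nat (vector_space.dim scale (A j)))"

lemma finite_weight_eq: "finite {m. weight m = j}"
proof -
  define F where "F = {f. \<forall>i. (i \<in> {..j} \<longrightarrow> f i \<in> {..j}) \<and> (i \<notin> {..j} \<longrightarrow> f i = (0::nat))}"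
  have bound: "(i + 1) * Poly_Mapping.lookup m i \<le> weight m" for m i
  proof (cases "i \<in> Poly_Mapping.keys m")
    case True
    then show ?thesis
      unfolding weight_def by (intro member_le_sum) auto
  qed (simp add: in_keys_iff)
  have "Poly_Mapping.lookup m \<in> F" if "weight m = j" for m
  proof -
    have "Poly_Mapping.lookup m i \<le> j" for i
      using bound[of i m] that by simp
    moreover have "Poly_Mapping.lookup m i = 0" if "\<not> i \<le> j" for i
      using bound[of i m] that \<open>weight m = j\<close> by (cases "Poly_Mapping.lookup m i") auto
    ultimately show ?thesis by (auto simp: F_def)
  qed
  then have "Poly_Mapping.lookup ` {m. weight m = j} \<subseteq> F"
    by blast
  moreover have "finite F"
    unfolding F_def by (rule finite_set_of_finite_funs) auto
  ultimately have "finite (Poly_Mapping.lookup ` {m. weight m = j})"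
    by (rule finite_subset)
  then show ?thesis
    by (rule finite_imageD) (simp add: inj_on_def lookup_inject)
qed

lemma arc_piece_subspace: "arc_algebra.subspace (arc_piece j)"
proof (rule arc_algebra.subspaceI)
  show "0 \<in> arc_piece j"
    unfolding arc_piece_def homogeneous_of_weight_def zero_arc_algebra_def by auto
next
  fix x y :: "'a arc_algebra"
  assume "x \<in> arc_piece j" "y \<in> arc_piece j"
  then obtain p q where pq: "x = arc_class p" "y = arc_class q"
      "p \<in> homogeneous_of_weight j" "q \<in> homogeneous_of_weight j"
    unfolding arc_piece_def by blast
  then have "p + q \<in> homogeneous_of_weight j"
    using Poly_Mapping.keys_add[of p q] unfolding homogeneous_of_weight_def by blast
  with pq show "x + y \<in> arc_piece j"
    unfolding arc_piece_def by (auto simp: plus_arc_algebra.abs_eq)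
next
  fix c :: 'a and x :: "'a arc_algebra"
  assume "x \<in> arc_piece j"
  then obtain p where p: "x = arc_class p" "p \<in> homogeneous_of_weight j"
    unfolding arc_piece_def by blast
  then have "arc_const c * p \<in> homogeneous_of_weight j"
    using keys_mult[of "arc_const c" p] unfolding homogeneous_of_weight_def arc_const_def
    by (auto split: if_splits)
  with p show "arc_scale c x \<in> arc_piece j"
    unfolding arc_piece_def by (auto simp: arc_scale.abs_eq)
qed

lemma arc_piece_finite_dim: "\<exists>B. finite B \<and> arc_piece j \<subseteq> arc_algebra.span B"
proof (intro exI conjI subsetI)
  let ?B = "(\<lambda>m. arc_class (Poly_Mapping.single m 1)) ` {m. weight m = j}"
  show "finite ?B"
    using finite_weight_eq by simp
  fix x :: "'a arc_algebra"
  assume "x \<in> arc_piece j"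
  then obtain p where p: "x = arc_class p" "\<And>m. m \<in> Poly_Mapping.keys p \<Longrightarrow> weight m = j"
    unfolding arc_piece_def homogeneous_of_weight_def by blast
  have sum: "arc_class (\<Sum>m\<in>M. f m) = (\<Sum>m\<in>M. arc_class (f m))"
    if "finite M" for M and f :: "arc_monomial \<Rightarrow> 'a arc_poly"
    using that
    by (induction M) (simp_all add: zero_arc_algebra_def plus_arc_algebra.abs_eq[symmetric])
  have "p = (\<Sum>m\<in>Poly_Mapping.keys p. Poly_Mapping.single m (Poly_Mapping.lookup p m))"
    by (rule poly_mapping_eqI)
      (auto simp: lookup_sum lookup_single when_def sum.delta in_keys_iff)
  then have "x = (\<Sum>m\<in>Poly_Mapping.keys p.
      arc_class (Poly_Mapping.single m (Poly_Mapping.lookup p m)))"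
    using p(1) sum[OF finite_keys] by metis
  also have "\<dots> = (\<Sum>m\<in>Poly_Mapping.keys p.
      arc_scale (Poly_Mapping.lookup p m) (arc_class (Poly_Mapping.single m 1)))"
    by (simp add: arc_scale.abs_eq arc_const_def mult_single)
  also have "\<dots> \<in> arc_algebra.span ?B"
    using p(2) by (intro arc_algebra.span_sum arc_algebra.span_scale arc_algebra.span_base) auto
  finally show "x \<in> arc_algebra.span ?B" .
qed

end

theory Submission
  imports Defs "HOL-Combinatorics.Permutations"
begin

text \<open>
  Call a monomial standard if it is squarefree and contains no two consecutive variables. The
  standard monomials of weight $j$ form a basis of the piece of degree $j$. They span because the
  relation $f_l$ can be solved for its term with the two closest indices. For independence, let
  $I_0 < \dots < I_{n-1}$ and pair a polynomial, as a differential operator, with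
  $\sum_\sigma \mathrm{sgn}(\sigma) \prod_i y_{I_{\sigma(i)} + i}$. Multiples of $f_l$ act as
  $0$, since composing $\sigma$ with a transposition preserves the sum of the two indices
  concerned and changes the sign. The standard monomials are exactly the diagonal terms
  $\prod_i y_{I_i + i}$, and by the rearrangement inequality these functionals are triangular on
  them with respect to the sum of the squares of the indices. Finally, \<open>A d\<close> counts the standard
  monomials in the variables of weight at most $d - 2$: the recurrence splits them by divisibility
  by the last of these. Indices here start at $0$, so the index is one less than the weight.
\<close>

section \<open>Monomials\<close>

abbreviation "ymon k \<equiv> Poly_Mapping.single k (1::nat) :: arc_monomial"

text \<open>The weights are left general so that one additivity law serves both the grading and the
  moment.\<close>

definition weighted_degree :: "(nat \<Rightarrow> nat) \<Rightarrow> arc_monomial \<Rightarrow> nat" where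
  "weighted_degree w m = (\<Sum>k\<in>Poly_Mapping.keys m. w k * Poly_Mapping.lookup m k)"

lemma weighted_degree_superset:
  assumes "finite S" "Poly_Mapping.keys m \<subseteq> S"
  shows "weighted_degree w m = (\<Sum>k\<in>S. w k * Poly_Mapping.lookup m k)"
  unfolding weighted_degree_def using assms
  by (intro sum.mono_neutral_left) (auto simp: in_keys_iff)

lemma weighted_degree_add: "weighted_degree w (m + m') = weighted_degree w m + weighted_degree w m'"
proof -
  let ?S = "Poly_Mapping.keys m \<union> Poly_Mapping.keys m'"
  have "Poly_Mapping.keys (m + m') \<subseteq> ?S"
    by (rule Poly_Mapping.keys_add)
  then show ?thesis
    by (simp add: weighted_degree_superset[of ?S] lookup_add distrib_left sum.distrib)
qed

lemma weighted_degree_single [simp]: "weighted_degree w (Poly_Mapping.single k n) = w k * n"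
  by (simp add: weighted_degree_def)

lemma weighted_degree_0 [simp]: "weighted_degree w 0 = 0"
  by (simp add: weighted_degree_def)

lemma weighted_degree_sum: "weighted_degree w (\<Sum>i\<in>S. f i) = (\<Sum>i\<in>S. weighted_degree w (f i))"
  by (induction S rule: infinite_finite_induct) (simp_all add: weighted_degree_add)

lemma weight_eq: "weight = weighted_degree Suc"
  by (simp add: fun_eq_iff weight_def weighted_degree_def)

text \<open>The order behind both halves: among pairs of indices with a given sum, the closest ones
  have the least sum of squares.\<close>

abbreviation "moment \<equiv> weighted_degree (\<lambda>k. k\<^sup>2)"

text \<open>The value of \<partial>^m on y^m, which normalises the pairing of operators with
  monomials.\<close>

definition monomial_fact :: "arc_monomial \<Rightarrow> nat" where
  "monomial_fact m = (\<Prod>k\<in>Poly_Mapping.keys m. fact (Poly_Mapping.lookup m k))"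

lemma monomial_fact_single_add:
  "monomial_fact (ymon b + m) = (Poly_Mapping.lookup m b + 1) * monomial_fact m"
proof -
  let ?S = "insert b (Poly_Mapping.keys m)"
  have sup: "monomial_fact m' = (\<Prod>k\<in>?S. fact (Poly_Mapping.lookup m' k))"
    if "Poly_Mapping.keys m' \<subseteq> ?S" for m'
    unfolding monomial_fact_def using that
    by (intro prod.mono_neutral_left) (auto simp: in_keys_iff)
  have "Poly_Mapping.keys (ymon b + m) \<subseteq> ?S"
    using Poly_Mapping.keys_add[of "ymon b" m] by auto
  then have "monomial_fact (ymon b + m) = (\<Prod>k\<in>?S. fact (Poly_Mapping.lookup (ymon b + m) k))"
    by (rule sup)
  also have "\<dots> = fact (Poly_Mapping.lookup m b + 1) *
      (\<Prod>k\<in>?S - {b}. fact (Poly_Mapping.lookup (ymon b + m) k))"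
    by (subst prod.remove[of _ b]) (auto simp: lookup_add)
  also have "(\<Prod>k\<in>?S - {b}. fact (Poly_Mapping.lookup (ymon b + m) k)) =
      (\<Prod>k\<in>?S - {b}. fact (Poly_Mapping.lookup m k) :: nat)"
    by (intro prod.cong) (auto simp: lookup_add lookup_single)
  also have "fact (Poly_Mapping.lookup m b + 1) * \<dots> =
      (Poly_Mapping.lookup m b + 1) * (\<Prod>k\<in>?S. fact (Poly_Mapping.lookup m k))"
    by (subst (2) prod.remove[of _ b]) (auto simp: algebra_simps)
  finally show ?thesis
    by (simp only: sup[OF subset_insertI, symmetric])
qed

text \<open>A single inequality excludes both a square and a product of two neighbours, that is, the
  terms of the relations whose indices are closest.\<close>

definition standard :: "arc_monomial \<Rightarrow> bool" where
  "standard m \<longleftrightarrow> (\<forall>i. Poly_Mapping.lookup m i + Poly_Mapping.lookup m (Suc i) \<le> 1)"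

lemma standard_lookup_le: "standard m \<Longrightarrow> Poly_Mapping.lookup m i \<le> 1"
  unfolding standard_def using add_leD1 by blast

lemma monomial_fact_standard: "standard m \<Longrightarrow> monomial_fact m = 1"
  unfolding monomial_fact_def
proof (intro prod.neutral ballI)
  fix k assume "standard m"
  then have "Poly_Mapping.lookup m k = 0 \<or> Poly_Mapping.lookup m k = 1"
    using standard_lookup_le[of m k] by linarith
  then show "fact (Poly_Mapping.lookup m k) = (1 :: nat)"
    by auto
qed

section \<open>Functionals that vanish on the ideal\<close>

text \<open>The monomial $y^m$ pairs with a product $\prod_{k \in S} y_{a_k}$ as the differential operator
  $\partial^m$ applied to it; the next lemma is the Leibniz rule for one factor $\partial_b$.\<close>

lemma monomial_fact_Leibniz:
  fixes a :: "nat \<Rightarrow> nat"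
  assumes "finite S"
  shows "monomial_fact (ymon b + m) * of_bool ((\<Sum>k\<in>S. ymon (a k)) = ymon b + m) =
    (\<Sum>i\<in>S. monomial_fact m * of_bool (a i = b \<and> (\<Sum>k\<in>S - {i}. ymon (a k)) = m))"
proof -
  let ?c = "(\<Sum>k\<in>S. ymon (a k)) = ymon b + m"
  have eq: "a i = b \<and> (\<Sum>k\<in>S - {i}. ymon (a k)) = m \<longleftrightarrow> a i = b \<and> ?c" if "i \<in> S" for i
    using that assms by (auto simp: sum.remove)
  have "(\<Sum>i\<in>S. monomial_fact m * of_bool (a i = b \<and> (\<Sum>k\<in>S - {i}. ymon (a k)) = m)) =
      (\<Sum>i\<in>S. monomial_fact m * (of_bool (a i = b) * of_bool ?c))"
    by (intro sum.cong refl) (simp only: eq of_bool_conj)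
  also have "\<dots> = monomial_fact m * ((\<Sum>i\<in>S. of_bool (a i = b)) * of_bool ?c)"
    by (simp only: sum_distrib_left sum_distrib_right)
  also have "\<dots> = monomial_fact m * ((Poly_Mapping.lookup m b + 1) * of_bool ?c)"
  proof (cases ?c)
    case True
    \<comment> \<open>The factors equal to y_b are counted by the exponent of y_b in the whole
      product.\<close>
    have "(\<Sum>i\<in>S. of_bool (a i = b)) = Poly_Mapping.lookup (\<Sum>k\<in>S. ymon (a k)) b"
      by (auto simp: lookup_sum lookup_single when_def intro!: sum.cong)
    with True show ?thesis
      by (simp add: lookup_add)
  qed simp
  finally show ?thesis
    by (simp only: monomial_fact_single_add mult.left_commute mult.assoc mult.commute)
qed

text \<open>Apply the rule twice: \<partial>_b removes the factor at \<open>i\<close>, then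
  \<partial>_c one at another position \<open>j\<close>. Ordered pairs of positions make a separate
  case \<open>b = c\<close> unnecessary.\<close>

lemma monomial_fact_Leibniz2:
  fixes a :: "nat \<Rightarrow> nat"
  assumes "finite S"
  shows "monomial_fact (ymon b + (ymon c + m)) * of_bool ((\<Sum>k\<in>S. ymon (a k)) = ymon b + (ymon c + m)) =
    (\<Sum>i\<in>S. \<Sum>j\<in>S - {i}. monomial_fact m *
      of_bool (a i = b \<and> a j = c \<and> (\<Sum>k\<in>S - {i} - {j}. ymon (a k)) = m))"
proof -
  have "monomial_fact (ymon c + m) * of_bool (a i = b \<and> (\<Sum>k\<in>S - {i}. ymon (a k)) = ymon c + m) =
    (\<Sum>j\<in>S - {i}. monomial_fact m *
      of_bool (a i = b \<and> a j = c \<and> (\<Sum>k\<in>S - {i} - {j}. ymon (a k)) = m))" for i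
    using monomial_fact_Leibniz[of "S - {i}" c m a] assms
    by (cases "a i = b") simp_all
  then show ?thesis
    unfolding monomial_fact_Leibniz[OF assms] by simp
qed

text \<open>The term of \<open>\<sigma>\<close> in the determinant of the matrix whose entry in row
  \<open>r\<close> and column \<open>i\<close> is the variable of index
  \<open>I r + i\<close>.\<close>

definition det_monomial :: "(nat \<Rightarrow> nat) \<Rightarrow> nat \<Rightarrow> (nat \<Rightarrow> nat) \<Rightarrow> arc_monomial" where
  "det_monomial I n \<sigma> = (\<Sum>i<n. ymon (I (\<sigma> i) + i))"

text \<open>The constant term of \<partial>^m applied to that determinant.\<close>

definition det_functional :: "(nat \<Rightarrow> nat) \<Rightarrow> nat \<Rightarrow> arc_monomial \<Rightarrow> 'a::comm_ring_1" where
  "det_functional I n m = (\<Sum>\<sigma>\<in>{\<sigma>. \<sigma> permutes {..<n}}.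
     of_int (sign \<sigma>) * of_nat (monomial_fact m * of_bool (det_monomial I n \<sigma> = m)))"

text \<open>Composition with the transposition is an involution that reverses signs and preserves
  \<open>F\<close>, so the sum equals its own negative.\<close>

lemma sum_sign_eq_0:
  fixes F :: "(nat \<Rightarrow> nat) \<Rightarrow> 'a::field_char_0"
  assumes "i < n" "j < n" "i \<noteq> j"
    and "\<And>\<sigma>. \<sigma> permutes {..<n} \<Longrightarrow> F (\<sigma> \<circ> transpose i j) = F \<sigma>"
  shows "(\<Sum>\<sigma>\<in>{\<sigma>. \<sigma> permutes {..<n}}. of_int (sign \<sigma>) * F \<sigma>) = 0"
proof -
  let ?P = "{\<sigma>. \<sigma> permutes {..<n}}" and ?t = "transpose i j"
  have t: "?t permutes {..<n}"
    using assms by (intro permutes_swap_id) auto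
  have "(\<Sum>\<sigma>\<in>?P. of_int (sign \<sigma>) * F \<sigma>) = (\<Sum>\<sigma>\<in>?P. of_int (sign (\<sigma> \<circ> ?t)) * F (\<sigma> \<circ> ?t))"
    using t by (intro sum.reindex_bij_witness[of _ "\<lambda>\<sigma>. \<sigma> \<circ> ?t" "\<lambda>\<sigma>. \<sigma> \<circ> ?t"])
      (auto simp: permutes_compose comp_assoc)
  also have "\<dots> = (\<Sum>\<sigma>\<in>?P. - (of_int (sign \<sigma>) * F \<sigma>))"
  proof (intro sum.cong refl)
    fix \<sigma> assume "\<sigma> \<in> ?P"
    then have "sign (\<sigma> \<circ> ?t) = - sign \<sigma>"
      using t \<open>i \<noteq> j\<close> by (subst sign_compose) (auto simp: sign_swap_id intro: permutation_permutes[THEN iffD2])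
    then show "of_int (sign (\<sigma> \<circ> ?t)) * F (\<sigma> \<circ> ?t) = - (of_int (sign \<sigma>) * F \<sigma>)"
      using assms(4) \<open>\<sigma> \<in> ?P\<close> by simp
  qed
  finally show ?thesis
    by (simp add: sum_negf)
qed

lemma sum_rotate:
  fixes g :: "'b \<Rightarrow> 'c \<Rightarrow> 'd \<Rightarrow> 'a::comm_monoid_add"
  shows "(\<Sum>a\<in>A. \<Sum>i\<in>B. \<Sum>j\<in>C i. g a i j) = (\<Sum>i\<in>B. \<Sum>j\<in>C i. \<Sum>a\<in>A. g a i j)"
  by (subst sum.swap) (intro sum.cong refl sum.swap)

text \<open>Summed over \<open>b\<close>, the operator removes any two factors at positions
  \<open>i\<close>, \<open>j\<close> whose indices add up to \<open>l\<close>. Exchanging the values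
  of \<open>\<sigma>\<close> there changes neither this sum nor the remaining factors, so the signed
  terms cancel.\<close>

lemma det_functional_equation:
  "(\<Sum>b\<le>l. det_functional I n (ymon b + (ymon (l - b) + m))) = (0 :: 'a::field_char_0)"
proof -
  define rest where "rest \<sigma> i j = (\<Sum>k\<in>{..<n} - {i} - {j}. ymon (I (\<sigma> k) + k))" for \<sigma> i j
  define F :: "nat \<Rightarrow> nat \<Rightarrow> (nat \<Rightarrow> nat) \<Rightarrow> nat" where
    "F i j \<sigma> = monomial_fact m * of_bool (I (\<sigma> i) + i + (I (\<sigma> j) + j) = l \<and> rest \<sigma> i j = m)" for i j \<sigma>
  have "(\<Sum>b\<le>l. monomial_fact (ymon b + (ymon (l - b) + m)) *
      of_bool (det_monomial I n \<sigma> = ymon b + (ymon (l - b) + m))) =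
      (\<Sum>i<n. \<Sum>j\<in>{..<n} - {i}. F i j \<sigma>)" for \<sigma>
  proof -
    \<comment> \<open>Only \<open>b = x\<close> can contribute, and it does so exactly when the two
      indices sum to \<open>l\<close>; hence \<open>F\<close> depends on that sum alone.\<close>
    have delta: "(\<Sum>b\<le>l. of_bool (x = b \<and> y = l - b \<and> r = m)) = (of_bool (x + y = l \<and> r = m) :: nat)"
      for x y :: nat and r
    proof -
      have "(\<Sum>b\<le>l. of_bool (x = b \<and> y = l - b \<and> r = m)) =
          (\<Sum>b\<le>l. if b = x then of_bool (y = l - x \<and> r = m) else (0 :: nat))"
        by (intro sum.cong) auto
      then show ?thesis
        by (auto simp: sum.delta)
    qed
    show ?thesis
      unfolding det_monomial_def F_def rest_def monomial_fact_Leibniz2[OF finite_lessThan]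
        sum_rotate
      by (simp only: sum_distrib_left[symmetric] delta)
  qed
  then have "(\<Sum>b\<le>l. det_functional I n (ymon b + (ymon (l - b) + m))) =
      (\<Sum>\<sigma>\<in>{\<sigma>. \<sigma> permutes {..<n}}.
        of_int (sign \<sigma>) * of_nat (\<Sum>i<n. \<Sum>j\<in>{..<n} - {i}. F i j \<sigma>) :: 'a)"
    unfolding det_functional_def
    by (subst sum.swap) (simp only: sum_distrib_left[symmetric] of_nat_sum[symmetric])
  also have "\<dots> = (\<Sum>i<n. \<Sum>j\<in>{..<n} - {i}.
      \<Sum>\<sigma>\<in>{\<sigma>. \<sigma> permutes {..<n}}. of_int (sign \<sigma>) * of_nat (F i j \<sigma>))"
    unfolding of_nat_sum sum_distrib_left
    by (rule sum_rotate)
  also have "\<dots> = 0"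
  proof (rule sum.neutral, rule ballI, rule sum.neutral, rule ballI)
    fix i j
    assume ij: "i \<in> {..<n}" "j \<in> {..<n} - {i}"
    have "F i j (\<sigma> \<circ> transpose i j) = F i j \<sigma>" for \<sigma>
    proof -
      have "rest (\<sigma> \<circ> transpose i j) i j = rest \<sigma> i j"
        unfolding rest_def by (intro sum.cong) (auto simp: transpose_def)
      then show ?thesis
        by (simp add: F_def algebra_simps)
    qed
    with ij show "(\<Sum>\<sigma>\<in>{\<sigma>. \<sigma> permutes {..<n}}. of_int (sign \<sigma>) * of_nat (F i j \<sigma>)) = (0 :: 'a)"
      by (intro sum_sign_eq_0[of i n j]) auto
  qed
  finally show ?thesis .
qed

section \<open>Extension from monomials to polynomials and vanishing on the ideal\<close>

definition linear_extension :: "(arc_monomial \<Rightarrow> 'a::comm_ring_1) \<Rightarrow> 'a arc_poly \<Rightarrow> 'a" where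
  "linear_extension f p = (\<Sum>m\<in>Poly_Mapping.keys p. Poly_Mapping.lookup p m * f m)"

lemma linear_extension_superset:
  assumes "finite S" "Poly_Mapping.keys p \<subseteq> S"
  shows "linear_extension f p = (\<Sum>m\<in>S. Poly_Mapping.lookup p m * f m)"
  unfolding linear_extension_def using assms
  by (intro sum.mono_neutral_left) (auto simp: in_keys_iff)

lemma linear_extension_0 [simp]: "linear_extension f 0 = 0"
  by (simp add: linear_extension_def)

lemma linear_extension_single [simp]: "linear_extension f (Poly_Mapping.single m c) = c * f m"
  by (simp add: linear_extension_def)

lemma linear_extension_add: "linear_extension f (p + q) = linear_extension f p + linear_extension f q"
proof -
  let ?S = "Poly_Mapping.keys p \<union> Poly_Mapping.keys q"
  have "Poly_Mapping.keys (p + q) \<subseteq> ?S"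
    by (rule Poly_Mapping.keys_add)
  then show ?thesis
    by (simp add: linear_extension_superset[of ?S] lookup_add distrib_right sum.distrib)
qed

lemma linear_extension_sum: "linear_extension f (\<Sum>i\<in>S. g i) = (\<Sum>i\<in>S. linear_extension f (g i))"
  by (induction S rule: infinite_finite_induct) (simp_all add: linear_extension_add)

lemma arc_poly_eq_sum:
  "p = (\<Sum>m\<in>Poly_Mapping.keys p. Poly_Mapping.single m (Poly_Mapping.lookup p m))"
  by (rule poly_mapping_eqI)
    (auto simp: lookup_sum lookup_single when_def sum.delta in_keys_iff)

text \<open>Each factor of the square carries one \<open>fps_X\<close>, whence the shift by 2: with
  indices from 0, the terms of f_l have index sum \<open>l - 2\<close>, and f_1 is zero.\<close>

lemma arc_equation_eq:
  "(arc_equation l :: 'a::comm_ring_1 arc_poly) = (if l < 2 then 0 else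
     \<Sum>b\<le>l - 2. Poly_Mapping.single (ymon b + ymon (l - 2 - b)) 1)"
proof -
  have "(generic_arc :: 'a arc_poly fps) ^ 2 = fps_X ^ 2 * (Abs_fps arc_var)\<^sup>2"
    by (simp add: generic_arc_def power_mult_distrib)
  then have "(arc_equation l :: 'a arc_poly) =
      (if l < 2 then 0 else fps_nth (Abs_fps arc_var * Abs_fps arc_var) (l - 2))"
    by (simp add: arc_equation_def fps_X_power_mult_nth power2_eq_square[of "Abs_fps arc_var"])
  then show ?thesis
    by (simp add: fps_mult_nth arc_var_def mult_single atLeast0AtMost)
qed

text \<open>The ideal is spanned linearly by the monomial multiples of the generators, and the
  hypothesis \<open>f\<close> is vanishing on these.\<close>

lemma linear_extension_arc_ideal:
  fixes f :: "arc_monomial \<Rightarrow> 'a::comm_ring_1"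
  assumes f: "\<And>l m. (\<Sum>b\<le>l. f (ymon b + (ymon (l - b) + m))) = 0" and p: "p \<in> arc_ideal"
  shows "linear_extension f p = 0"
proof -
  have monom: "linear_extension f (Poly_Mapping.single m c * arc_equation l) = 0" for m c l
  proof -
    have "(\<Sum>b\<le>l - 2. c * f (m + (ymon b + ymon (l - 2 - b)))) = 0"
      using f[of "l - 2" m] by (simp add: ac_simps flip: sum_distrib_left)
    then show ?thesis
      by (simp add: arc_equation_eq sum_distrib_left mult_single linear_extension_sum)
  qed
  have mult: "linear_extension f (q * arc_equation l) = 0" for q l
    by (subst arc_poly_eq_sum[of q])
      (simp add: sum_distrib_right linear_extension_sum monom)
  have "p \<in> module.span (*) (arc_equation ` {1..})"
    using p unfolding arc_ideal_def ideal_generated_by_def .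
  then show ?thesis
    by (rule module.span_induct_alt[OF module_mult])
      (auto simp: linear_extension_add mult)
qed

lemma det_functional_arc_ideal:
  fixes p :: "'a::field_char_0 arc_poly"
  shows "p \<in> arc_ideal \<Longrightarrow> linear_extension (det_functional I n) p = 0"
  by (rule linear_extension_arc_ideal[OF det_functional_equation])

section \<open>Independence of the standard monomials\<close>

text \<open>The maximum of $\sum_i i\, I_{\sigma(i)}$ is attained at the identity only, since exchanging
  the values of \<open>\<sigma>\<close> at an inversion increases it.\<close>

lemma rearrangement_strict:
  fixes I :: "nat \<Rightarrow> nat"
  assumes I: "\<And>i j. i < j \<Longrightarrow> j < n \<Longrightarrow> I i < I j"
    and \<sigma>: "\<sigma> permutes {..<n}" "\<sigma> \<noteq> id"
  shows "(\<Sum>i<n. i * I (\<sigma> i)) < (\<Sum>i<n. i * I i)"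
proof -
  define W where "W \<sigma> = (\<Sum>i<n. i * I (\<sigma> i))" for \<sigma>
  let ?P = "{\<sigma>. \<sigma> permutes {..<n}}"
  have improve: "\<exists>\<tau>\<in>?P. W \<sigma> < W \<tau>" if \<sigma>: "\<sigma> \<in> ?P" "\<sigma> \<noteq> id" for \<sigma>
  proof -
    have \<sigma>P: "\<sigma> permutes {..<n}"
      using \<sigma> by simp
    \<comment> \<open>Without an inversion \<open>\<sigma>\<close> is increasing, so
      \<open>i \<le> \<sigma> i\<close> throughout; as both sides have the same sum, equality holds
      everywhere.\<close>
    have "\<exists>i j. i < j \<and> j < n \<and> \<sigma> j < \<sigma> i"
    proof (rule ccontr)
      assume no: "\<nexists>i j. i < j \<and> j < n \<and> \<sigma> j < \<sigma> i"
      have mono: "\<sigma> i < \<sigma> j" if "i < j" "j < n" for i j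
      proof -
        have "\<sigma> i \<noteq> \<sigma> j"
          using that permutes_inj[OF \<sigma>P] by (auto dest: injD)
        with no that show ?thesis by (meson linorder_neqE_nat)
      qed
      have ge: "i \<le> \<sigma> i" if "i < n" for i
        using that
      proof (induction i)
        case (Suc i)
        then show ?case using mono[of i "Suc i"] by simp
      qed simp
      have "(\<Sum>i<n. \<sigma> i) = (\<Sum>i<n. i)"
        using sum.permute[OF \<sigma>P, of "\<lambda>i. i"] by simp
      then have "\<sigma> i = i" if "i < n" for i
        using sum_mono_inv[of "\<lambda>i. i" "{..<n}" \<sigma> i] ge that by simp
      then have "\<sigma> = id"
        using permutes_not_in[OF \<sigma>P] by (metis eq_id_iff lessThan_iff)
      with \<sigma> show False by simp
    qed
    then obtain i j where ij: "i < j" "j < n" "\<sigma> j < \<sigma> i"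
      by blast
    define \<tau> where "\<tau> = \<sigma> \<circ> transpose i j"
    have \<tau>: "\<tau> permutes {..<n}"
      unfolding \<tau>_def using ij \<sigma>P by (intro permutes_compose permutes_swap_id) auto
    have split: "W \<rho> = i * I (\<rho> i) + (j * I (\<rho> j) + (\<Sum>k\<in>{..<n} - {i} - {j}. k * I (\<rho> k)))" for \<rho>
      unfolding W_def using ij
      by (subst sum.remove[of _ i], simp_all, subst sum.remove[of _ j], simp_all)
    have rest: "(\<Sum>k\<in>{..<n} - {i} - {j}. k * I (\<tau> k)) = (\<Sum>k\<in>{..<n} - {i} - {j}. k * I (\<sigma> k))"
      unfolding \<tau>_def by (intro sum.cong) (auto simp: transpose_def)
    have "\<sigma> i < n"
      using permutes_in_image[OF \<sigma>P, of i] ij by auto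
    then have "I (\<sigma> j) < I (\<sigma> i)"
      using I ij by blast
    then obtain e where e: "I (\<sigma> i) = I (\<sigma> j) + e" "e > 0"
      using less_imp_add_positive by metis
    \<comment> \<open>The gain is \<open>(j - i) * e\<close>.\<close>
    have "W \<sigma> < W \<tau>"
      unfolding split[of \<sigma>] split[of \<tau>] rest using e ij
      by (simp add: \<tau>_def algebra_simps)
    with \<tau> show ?thesis by auto
  qed
  have fin: "finite ?P"
    by (rule finite_permutations) simp
  \<comment> \<open>A maximiser exists by finiteness and cannot be improved, so it is the identity.
    Improving the given \<open>\<sigma>\<close> once then yields the strict inequality.\<close>
  obtain \<tau> where \<tau>: "\<tau> \<in> ?P" "\<And>\<rho>. \<rho> \<in> ?P \<Longrightarrow> W \<rho> \<le> W \<tau>"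
  proof -
    have "Max (W ` ?P) \<in> W ` ?P"
      using fin permutes_id by (intro Max_in) blast+
    then obtain \<tau> where "\<tau> \<in> ?P" "W \<tau> = Max (W ` ?P)"
      by auto
    with that fin show ?thesis by simp
  qed
  then have "\<tau> = id"
    using improve[of \<tau>] by fastforce
  with improve[of \<sigma>] \<sigma> \<tau>(2) show ?thesis
    by (fastforce simp: W_def)
qed

text \<open>For a permutation only the cross term depends on \<open>\<sigma>\<close>, which reduces
  the comparison of moments to the rearrangement inequality.\<close>

lemma moment_det_monomial:
  "moment (det_monomial I n \<sigma>) = (\<Sum>i<n. (I (\<sigma> i))\<^sup>2) + (\<Sum>i<n. i\<^sup>2) + 2 * (\<Sum>i<n. i * I (\<sigma> i))"
  unfolding det_monomial_def
  by (simp add: weighted_degree_sum power2_sum sum.distrib sum_distrib_left mult.commute mult.left_commute)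

lemma moment_det_monomial_less:
  assumes I: "\<And>i j. i < j \<Longrightarrow> j < n \<Longrightarrow> I i < I j"
    and \<sigma>: "\<sigma> permutes {..<n}" "\<sigma> \<noteq> id"
  shows "moment (det_monomial I n \<sigma>) < moment (det_monomial I n id)"
proof -
  have "(\<Sum>i<n. (I (\<sigma> i))\<^sup>2) = (\<Sum>i<n. (I i)\<^sup>2)"
    using sum.permute[OF \<sigma>(1), of "\<lambda>i. (I i)\<^sup>2"] by (simp add: o_def)
  then show ?thesis
    using rearrangement_strict[OF I \<sigma>] by (simp add: moment_det_monomial)
qed

text \<open>Every off-diagonal term has smaller moment than the diagonal one, so only the identity,
  of sign 1, can contribute at \<open>m\<close>.\<close>

lemma det_functional_triangular:
  assumes I: "\<And>i j. i < j \<Longrightarrow> j < n \<Longrightarrow> I i < I j"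
    and m: "moment (det_monomial I n id) \<le> moment m"
  shows "det_functional I n m = of_nat (monomial_fact m * of_bool (m = det_monomial I n id))"
proof -
  have "(of_int (sign \<sigma>) * of_nat (monomial_fact m * of_bool (det_monomial I n \<sigma> = m)) :: 'a) =
      (if \<sigma> = id then of_nat (monomial_fact m * of_bool (m = det_monomial I n id)) else 0)"
    if \<sigma>: "\<sigma> permutes {..<n}" for \<sigma>
  proof (cases "\<sigma> = id")
    case False
    then have "det_monomial I n \<sigma> \<noteq> m"
      using moment_det_monomial_less[of n I \<sigma>] I \<sigma> m by (metis not_le)
    with False show ?thesis by simp
  qed auto
  then show ?thesis
    unfolding det_functional_def
    by (subst sum.cong[OF refl]) (auto simp: sum.delta finite_permutations permutes_id)
qed

text \<open>The indices occurring in \<open>m\<close>, listed increasingly, have gaps of at least 2;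
  subtracting \<open>i\<close> from the \<open>i\<close>-th one therefore leaves a strictly
  increasing sequence.\<close>

lemma standard_eq_det_monomial:
  assumes "standard m"
  obtains I n where "\<And>i j. i < j \<Longrightarrow> j < n \<Longrightarrow> I i < I j" "m = det_monomial I n id"
proof -
  define xs where "xs = sorted_list_of_set (Poly_Mapping.keys m)"
  define n where "n = length xs"
  define I where "I i = xs ! i - i" for i
  have set: "set xs = Poly_Mapping.keys m" and dist: "distinct xs"
    by (simp_all add: xs_def)
  have less: "xs ! i < xs ! j" if "i < j" "j < n" for i j
    using that strict_sorted_list_of_set[of "Poly_Mapping.keys m"]
    unfolding n_def xs_def by (simp add: sorted_wrt_iff_nth_less)
  have step: "xs ! i + 2 \<le> xs ! Suc i" if "Suc i < n" for i
  proof (rule ccontr)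
    assume "\<not> ?thesis"
    then have "xs ! Suc i = Suc (xs ! i)"
      using less[of i "Suc i"] that by simp
    moreover have "xs ! i \<in> Poly_Mapping.keys m" "xs ! Suc i \<in> Poly_Mapping.keys m"
      using that by (simp_all flip: set add: n_def)
    ultimately have "Poly_Mapping.lookup m (xs ! i) > 0" "Poly_Mapping.lookup m (Suc (xs ! i)) > 0"
      by (simp_all add: in_keys_iff)
    moreover have "Poly_Mapping.lookup m (xs ! i) + Poly_Mapping.lookup m (Suc (xs ! i)) \<le> 1"
      using assms unfolding standard_def by blast
    ultimately show False
      by linarith
  qed
  have ge: "i \<le> xs ! i" if "i < n" for i
    using that
  proof (induction i)
    case (Suc i)
    then show ?case using step[of i] by simp
  qed simp
  have "I i < I j" if "i < j" "j < n" for i j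
    using that
  proof (induction j)
    case (Suc j)
    have "I j < I (Suc j)"
      using step[of j] ge[of j] Suc.prems unfolding I_def by simp
    with Suc show ?case by (cases "i = j") auto
  qed simp
  moreover have "m = det_monomial I n id"
  proof -
    have "det_monomial I n id = (\<Sum>i<n. ymon (xs ! i))"
      unfolding det_monomial_def using ge by (intro sum.cong) (auto simp: I_def)
    also have "\<dots> = (\<Sum>k\<in>Poly_Mapping.keys m. ymon k)"
      using sum.reindex_bij_betw[OF bij_betw_nth[OF dist refl set[symmetric]], of ymon] by (simp add: n_def)
    also have "\<dots> = m"
    proof (rule poly_mapping_eqI)
      fix k
      show "Poly_Mapping.lookup (\<Sum>k\<in>Poly_Mapping.keys m. ymon k) k = Poly_Mapping.lookup m k"
        using standard_lookup_le[OF assms, of k]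
        by (auto simp: lookup_sum lookup_single when_def sum.delta in_keys_iff le_Suc_eq)
    qed
    finally show ?thesis ..
  qed
  ultimately show ?thesis
    by (rule that)
qed

text \<open>Test with the functional whose diagonal term is a monomial of least moment among those
  with nonzero coefficient: triangularity leaves just that coefficient, which must then
  vanish.\<close>

lemma standard_combination_in_arc_ideal:
  fixes c :: "arc_monomial \<Rightarrow> 'a::field_char_0"
  assumes "finite S" "\<And>m. m \<in> S \<Longrightarrow> standard m"
    and ideal: "(\<Sum>m\<in>S. Poly_Mapping.single m (c m)) \<in> arc_ideal" and "m \<in> S"
  shows "c m = 0"
proof (rule ccontr)
  assume "c m \<noteq> 0"
  then have "\<exists>m. m \<in> S \<and> c m \<noteq> 0"
    using \<open>m \<in> S\<close> by blast
  then obtain m0 where m0: "m0 \<in> S" "c m0 \<noteq> 0"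
    and min: "\<And>m'. m' \<in> S \<Longrightarrow> c m' \<noteq> 0 \<Longrightarrow> moment m0 \<le> moment m'"
    using ex_has_least_nat[of "\<lambda>m. m \<in> S \<and> c m \<noteq> 0" _ moment] by blast
  obtain I n where I: "\<And>i j. i < j \<Longrightarrow> j < n \<Longrightarrow> I i < I j" and m0_eq: "m0 = det_monomial I n id"
    using standard_eq_det_monomial assms(2)[OF m0(1)] by metis
  have "0 = linear_extension (det_functional I n) (\<Sum>m\<in>S. Poly_Mapping.single m (c m))"
    using det_functional_arc_ideal[OF ideal] by simp
  also have "\<dots> = (\<Sum>m\<in>S. c m * det_functional I n m)"
    by (simp add: linear_extension_sum)
  also have "\<dots> = (\<Sum>m\<in>S. if m = m0 then c m0 else 0)"
  proof (intro sum.cong refl)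
    fix m assume "m \<in> S"
    then show "c m * det_functional I n m = (if m = m0 then c m0 else 0)"
      using det_functional_triangular[of n I m, where 'a = 'a, OF I] min[of m] assms(2)[of m]
      by (cases "c m = 0") (auto simp: m0_eq monomial_fact_standard)
  qed
  also have "\<dots> = c m0"
    using m0(1) \<open>finite S\<close> by simp
  finally show False
    using m0(2) by simp
qed

section \<open>The graded pieces of the arc algebra\<close>

definition monomial_class :: "arc_monomial \<Rightarrow> 'a::comm_ring_1 arc_algebra" where
  "monomial_class m = arc_class (Poly_Mapping.single m 1)"

definition standard_monomials :: "nat \<Rightarrow> arc_monomial set" where
  "standard_monomials j = {m. standard m \<and> weight m = j}"

lemma finite_standard_monomials: "finite (standard_monomials j)"
  unfolding standard_monomials_def by (rule finite_subset[OF _ finite_weight_eq[of j]]) auto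

lemma arc_class_sum: "arc_class (\<Sum>i\<in>S. f i) = (\<Sum>i\<in>S. arc_class (f i))"
  by (induction S rule: infinite_finite_induct)
    (simp_all add: zero_arc_algebra_def plus_arc_algebra.abs_eq[symmetric])

lemma arc_class_eq_0_iff: "arc_class p = 0 \<longleftrightarrow> p \<in> arc_ideal"
  unfolding zero_arc_algebra_def by (simp add: arc_algebra.abs_eq_iff arc_cong_def)

lemma arc_class_single: "arc_class (Poly_Mapping.single m c) = arc_scale c (monomial_class m)"
  by (simp add: monomial_class_def arc_scale.abs_eq arc_const_def mult_single)

section \<open>Spanning by standard monomials\<close>

lemma monomial_class_relation:
  "(\<Sum>b\<le>l. monomial_class (ymon b + (ymon (l - b) + m))) = (0 :: 'a::comm_ring_1 arc_algebra)"
proof -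
  have "arc_equation (l + 2) \<in> (arc_ideal :: 'a arc_poly set)"
    unfolding arc_ideal_def ideal_generated_by_def
    by (intro module.span_base[OF module_mult]) auto
  then have "Poly_Mapping.single m 1 * arc_equation (l + 2) \<in> (arc_ideal :: 'a arc_poly set)"
    by (rule arc_ideal_mult)
  also have "Poly_Mapping.single m 1 * arc_equation (l + 2) =
      (\<Sum>b\<le>l. Poly_Mapping.single (ymon b + (ymon (l - b) + m)) (1 :: 'a))"
    by (simp add: arc_equation_eq sum_distrib_left mult_single ac_simps)
  finally show ?thesis
    by (simp add: monomial_class_def arc_class_sum flip: arc_class_eq_0_iff)
qed

text \<open>Two neighbouring exponents with sum at least 2 contain a square of one variable or the
  product of both. In either case \<open>i\<close> and \<open>k\<close> are the closest indices with
  their sum.\<close>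

lemma not_standardE:
  assumes "\<not> standard m"
  obtains i k m' where "k = i \<or> k = Suc i" "m = ymon i + (ymon k + m')"
proof -
  note decomposition = that
  obtain i where i: "\<not> Poly_Mapping.lookup m i + Poly_Mapping.lookup m (Suc i) \<le> 1"
    using assms unfolding standard_def by blast
  have split: "\<exists>m'. m = ymon a + m'" if "Poly_Mapping.lookup m a > 0" for m :: arc_monomial and a
  proof
    show "m = ymon a + (m - ymon a)"
      using that by (intro poly_mapping_eqI) (auto simp: lookup_add lookup_minus lookup_single when_def)
  qed
  have split2: thesis if a: "k = a \<or> k = Suc a" "Poly_Mapping.lookup m a > 0"
    "Poly_Mapping.lookup m k > of_bool (k = a)" for a k
  proof -
    obtain m1 where m1: "m = ymon a + m1"
      using split a(2) by blast
    with a have "Poly_Mapping.lookup m1 k > 0"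
      by (auto simp: lookup_add lookup_single when_def split: if_splits)
    then obtain m2 where "m1 = ymon k + m2"
      using split by blast
    with m1 have "m = ymon a + (ymon k + m2)"
      by simp
    with a(1) show thesis
      by (rule decomposition)
  qed
  consider "Poly_Mapping.lookup m i \<ge> 2" | "Poly_Mapping.lookup m (Suc i) \<ge> 2"
    | "Poly_Mapping.lookup m i \<ge> 1" "Poly_Mapping.lookup m (Suc i) \<ge> 1"
    using i by linarith
  then show thesis
  proof cases
    case 1
    then show thesis by (intro split2[of i i]) auto
  next
    case 2
    then show thesis by (intro split2[of "Suc i" "Suc i"]) auto
  next
    case 3
    then show thesis by (intro split2[of "Suc i" i]) auto
  qed
qed

text \<open>No integer lies strictly between \<open>i\<close> and \<open>k\<close>, so
  \<open>b\<close> lies outside their range, say at distance \<open>e\<close>. The sum of squares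
  then grows by \<open>2 * e * (k - i + e)\<close>.\<close>

lemma sum_squares_less:
  fixes i k b c :: nat
  assumes "k = i \<or> k = Suc i" "b + c = i + k" "b \<noteq> i" "b \<noteq> k"
  shows "i\<^sup>2 + k\<^sup>2 < b\<^sup>2 + c\<^sup>2"
proof -
  have "b < i \<or> b > k"
    using assms by linarith
  then show ?thesis
  proof
    assume "b < i"
    then obtain e where "i = b + e" "e > 0"
      using less_imp_add_positive by metis
    moreover from this have "c = k + e"
      using assms by simp
    ultimately show ?thesis
      using assms by (auto simp: power2_eq_square algebra_simps)
  next
    assume "b > k"
    then obtain e where "b = k + e" "e > 0"
      using less_imp_add_positive by metis
    moreover from this have "i = c + e"
      using assms by simp
    ultimately show ?thesis
      using assms by (auto simp: power2_eq_square algebra_simps)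
  qed
qed

text \<open>Solving the relation of degree $l$ for $y_{l/2}^2$ or $2 y_{(l-1)/2} y_{(l+1)/2}$ rewrites a
  nonstandard monomial in terms of monomials of larger moment; there are finitely many of each
  weight.\<close>

lemma monomial_class_in_span:
  "monomial_class m \<in> arc_algebra.span
     (monomial_class ` standard_monomials (weight m) :: 'a::field_char_0 arc_algebra set)"
proof -
  \<comment> \<open>The largest moment in a given weight; the induction goes upwards along the
    moment and stays within one weight.\<close>
  define N where "N j = Max (moment ` {m. weight m = j})" for j
  have N: "moment m \<le> N (weight m)" for m
    unfolding N_def by (intro Max_ge finite_imageI finite_weight_eq) auto
  show ?thesis
  proof (induction "N (weight m) - moment m" arbitrary: m rule: less_induct)
    case less
    let ?V = "arc_algebra.span
      (monomial_class ` standard_monomials (weight m) :: 'a arc_algebra set)"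
    show ?case
    proof (cases "standard m")
      case True
      then show ?thesis
        by (intro arc_algebra.span_base) (simp add: standard_monomials_def)
    next
      case False
      then obtain i k m' where ik: "k = i \<or> k = Suc i" and m: "m = ymon i + (ymon k + m')"
        by (rule not_standardE)
      define l where "l = i + k"
      define f where "f b = (monomial_class (ymon b + (ymon (l - b) + m')) :: 'a arc_algebra)" for b
      have "f b \<in> ?V" if b: "b \<in> {..l} - {i, k}" for b
      proof -
        let ?m = "ymon b + (ymon (l - b) + m')"
        have w: "weight ?m = weight m"
          using b by (simp add: weight_eq weighted_degree_add m l_def)
        have "moment m < moment ?m"
          using sum_squares_less[OF ik, of b "l - b"] b
          by (simp add: weighted_degree_add m l_def)
        then show ?thesis
          using less[of ?m] N[of ?m] unfolding w f_def by linarith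
      qed
      then have rest: "(\<Sum>b\<in>{..l} - {i, k}. f b) \<in> ?V"
        by (rule arc_algebra.span_sum)
      have "(\<Sum>b\<in>{..l}. f b) = (\<Sum>b\<in>{..l} - {i, k}. f b) + (\<Sum>b\<in>{i, k}. f b)"
        by (rule sum.subset_diff) (auto simp: l_def)
      moreover have "(\<Sum>b\<in>{..l}. f b) = 0"
        unfolding f_def by (rule monomial_class_relation)
      ultimately have "(\<Sum>b\<in>{i, k}. f b) = - (\<Sum>b\<in>{..l} - {i, k}. f b)"
        by (simp add: eq_neg_iff_add_eq_0 add.commute)
      then have V: "(\<Sum>b\<in>{i, k}. f b) \<in> ?V"
        using arc_algebra.span_neg[OF rest] by simp
      have f: "f i = monomial_class m" "f k = monomial_class m"
        by (simp_all add: f_def m l_def ac_simps)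
      show ?thesis
      \<comment> \<open>The extremal monomial occurs once in the relation if \<open>k = i\<close>,
        and twice otherwise; then 2 has to be inverted.\<close>
      proof (cases "k = i")
        case True
        with V f show ?thesis by simp
      next
        case False
        then have "(\<Sum>b\<in>{i, k}. f b) = f i + f k"
          by simp
        also have "\<dots> = arc_scale (1 + 1) (monomial_class m)"
          unfolding f arc_algebra.scale_left_distrib arc_algebra.scale_one ..
        finally have "arc_scale 2 (monomial_class m) \<in> ?V"
          using V by (simp only: one_add_one)
        then have "arc_scale (1 / 2) (arc_scale 2 (monomial_class m)) \<in> ?V"
          by (rule arc_algebra.span_scale)
        then show ?thesis by simp
      qed
    qed
  qed
qed

section \<open>Independence and dimension of the graded pieces\<close>

lemma standard_monomials_independent:
  fixes c :: "arc_monomial \<Rightarrow> 'a::field_char_0"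
  assumes "(\<Sum>m\<in>standard_monomials j. arc_scale (c m) (monomial_class m)) = 0"
    and "m \<in> standard_monomials j"
  shows "c m = 0"
proof (rule standard_combination_in_arc_ideal)
  show "(\<Sum>m\<in>standard_monomials j. Poly_Mapping.single m (c m)) \<in> arc_ideal"
    using assms(1) by (simp add: arc_class_sum arc_class_single flip: arc_class_eq_0_iff)
qed (use assms(2) finite_standard_monomials in \<open>auto simp: standard_monomials_def\<close>)

text \<open>Two equal classes would give a relation with coefficients 1 and -1. Injectivity lets the
  dimension be read off from the number of monomials.\<close>

lemma inj_on_monomial_class:
  "inj_on (monomial_class :: _ \<Rightarrow> 'a::field_char_0 arc_algebra) (standard_monomials j)"
proof (rule inj_onI, rule ccontr)
  let ?S = "standard_monomials j"
  fix m m'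
  assume m: "m \<in> ?S" "m' \<in> ?S" "m \<noteq> m'"
    and eq: "monomial_class m = (monomial_class m' :: 'a arc_algebra)"
  define c where "c k = (if k = m then 1 else if k = m' then - 1 else 0 :: 'a)" for k
  have "(\<Sum>k\<in>?S. arc_scale (c k) (monomial_class k)) =
      (\<Sum>k\<in>{m, m'}. arc_scale (c k) (monomial_class k))"
    using m finite_standard_monomials by (intro sum.mono_neutral_right) (auto simp: c_def)
  also have "\<dots> = 0"
    using m eq by (simp add: c_def)
  finally have "c m = 0"
    using m(1) by (rule standard_monomials_independent)
  then show False
    by (simp add: c_def)
qed

lemma dim_arc_piece:
  "arc_algebra.dim (arc_piece j :: 'a::field_char_0 arc_algebra set) = card (standard_monomials j)"
proof (rule arc_algebra.dim_unique)
  let ?B = "monomial_class ` standard_monomials j :: 'a arc_algebra set"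
  show "?B \<subseteq> arc_piece j"
    unfolding arc_piece_def monomial_class_def
    by (auto simp: standard_monomials_def homogeneous_of_weight_def)
  show "arc_piece j \<subseteq> arc_algebra.span ?B"
  proof
    fix x :: "'a arc_algebra"
    assume "x \<in> arc_piece j"
    then obtain p where p: "x = arc_class p" "\<And>m. m \<in> Poly_Mapping.keys p \<Longrightarrow> weight m = j"
      unfolding arc_piece_def homogeneous_of_weight_def by blast
    have "x = arc_class (\<Sum>m\<in>Poly_Mapping.keys p. Poly_Mapping.single m (Poly_Mapping.lookup p m))"
      using p(1) arc_poly_eq_sum[of p] by simp
    also have "\<dots> = (\<Sum>m\<in>Poly_Mapping.keys p. arc_scale (Poly_Mapping.lookup p m) (monomial_class m))"
      by (simp add: arc_class_sum arc_class_single)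
    also have "\<dots> \<in> arc_algebra.span ?B"
    proof (intro arc_algebra.span_sum arc_algebra.span_scale)
      fix m assume "m \<in> Poly_Mapping.keys p"
      then show "monomial_class m \<in> arc_algebra.span ?B"
        using monomial_class_in_span[of m, where 'a = 'a] p(2) by simp
    qed
    finally show "x \<in> arc_algebra.span ?B" .
  qed
  show "arc_algebra.independent ?B"
  proof (rule arc_algebra.independent_if_scalars_zero)
    fix c :: "'a arc_algebra \<Rightarrow> 'a" and x
    assume "(\<Sum>x\<in>?B. arc_scale (c x) x) = 0" "x \<in> ?B"
    then show "c x = 0"
      using standard_monomials_independent[of "\<lambda>m. c (monomial_class m)" j]
      by (auto simp: sum.reindex[OF inj_on_monomial_class])
  qed (simp add: finite_standard_monomials)
  show "card ?B = card (standard_monomials j)"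
    by (rule card_image[OF inj_on_monomial_class])
qed

section \<open>Counting standard monomials\<close>

text \<open>Indices below \<open>r\<close> are the variables of weight at most \<open>r\<close>;
  \<open>A d\<close> will correspond to \<open>r = d - 2\<close>.\<close>

definition bounded_standard_monomials :: "nat \<Rightarrow> nat \<Rightarrow> arc_monomial set" where
  "bounded_standard_monomials r j =
     {m \<in> standard_monomials j. \<forall>i\<ge>r. Poly_Mapping.lookup m i = 0}"

lemma weight_ge_lookup: "(i + 1) * Poly_Mapping.lookup m i \<le> weight m"
proof (cases "i \<in> Poly_Mapping.keys m")
  case True
  then show ?thesis
    unfolding weight_def by (intro member_le_sum) auto
qed (simp add: in_keys_iff)

lemma bounded_standard_monomials_0:
  "bounded_standard_monomials 0 j = (if j = 0 then {0} else {})"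
proof -
  have 0: "(\<forall>i\<ge>0. Poly_Mapping.lookup m i = 0) \<longleftrightarrow> m = 0" for m :: arc_monomial
    by (simp add: poly_mapping_eq_iff fun_eq_iff)
  have "0 \<in> standard_monomials j \<longleftrightarrow> j = 0"
    by (auto simp: standard_monomials_def standard_def weight_eq)
  then show ?thesis
    unfolding bounded_standard_monomials_def 0 by auto
qed

text \<open>A variable of index at least \<open>r\<close> has weight greater than \<open>j\<close>,
  so the bound holds automatically.\<close>

lemma bounded_standard_monomials_eq:
  assumes "j \<le> r"
  shows "bounded_standard_monomials r j = standard_monomials j"
proof -
  have "Poly_Mapping.lookup m i = 0" if "weight m = j" "r \<le> i" for m i
    using weight_ge_lookup[of i m] that assms by (cases "Poly_Mapping.lookup m i") auto
  then show ?thesis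
    by (auto simp: bounded_standard_monomials_def standard_monomials_def)
qed

text \<open>Split by whether the variable of index \<open>r\<close> occurs. If it does, its exponent
  is 1 and index \<open>r - 1\<close> is absent; dividing by it lowers the weight by
  \<open>Suc r\<close> and leaves indices below \<open>r - 1\<close>.\<close>

lemma card_bounded_standard_monomials_Suc:
  "card (bounded_standard_monomials (Suc r) j) = card (bounded_standard_monomials r j) +
    (if Suc r \<le> j then card (bounded_standard_monomials (r - 1) (j - Suc r)) else 0)"
proof -
  let ?T = "{m \<in> bounded_standard_monomials (Suc r) j. Poly_Mapping.lookup m r \<noteq> 0}"
  let ?B = "bounded_standard_monomials"
  have fin: "finite (?B s i)" for s i
    unfolding bounded_standard_monomials_def by (simp add: finite_standard_monomials)
  have split: "?B (Suc r) j = ?B r j \<union> ?T"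
  proof -
    have "(\<forall>i\<ge>r. f i = 0) \<longleftrightarrow> f r = 0 \<and> (\<forall>i\<ge>Suc r. f i = 0)" for f :: "nat \<Rightarrow> nat"
      by (metis Suc_leD Suc_leI le_neq_implies_less order_refl)
    then show ?thesis
      unfolding bounded_standard_monomials_def by auto
  qed
  have disj: "?B r j \<inter> ?T = {}"
    unfolding bounded_standard_monomials_def by auto
  have T: "?T = (if Suc r \<le> j then (\<lambda>m. ymon r + m) ` ?B (r - 1) (j - Suc r) else {})"
  proof (cases "Suc r \<le> j")
    case True
    have "m \<in> (\<lambda>m. ymon r + m) ` ?B (r - 1) (j - Suc r)" if m: "m \<in> ?T" for m
    proof -
      have std: "standard m" and w: "weight m = j" and bd: "\<And>i. i > r \<Longrightarrow> Poly_Mapping.lookup m i = 0"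
        and "Poly_Mapping.lookup m r \<noteq> 0"
        using m by (auto simp: bounded_standard_monomials_def standard_monomials_def)
      then have r1: "Poly_Mapping.lookup m r = 1"
        using standard_lookup_le[OF std, of r] by simp
      have pred: "Poly_Mapping.lookup m (r - 1) = 0" if "r > 0"
        using std[unfolded standard_def, rule_format, of "r - 1"] r1 that by simp
      define m' where "m' = m - ymon r"
      have eq: "m = ymon r + m'"
        unfolding m'_def using r1
        by (intro poly_mapping_eqI) (auto simp: lookup_add lookup_minus lookup_single when_def)
      have le: "Poly_Mapping.lookup m' i \<le> Poly_Mapping.lookup m i" for i
        unfolding eq by (simp add: lookup_add)
      have "standard m'"
        using std unfolding standard_def by (blast intro: order_trans[OF add_mono[OF le le]])
      moreover have "weight m' = j - Suc r"
        using w unfolding eq by (simp add: weight_eq weighted_degree_add)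
      moreover have "Poly_Mapping.lookup m' i = 0" if "i \<ge> r - 1" for i
      proof -
        \<comment> \<open>For \<open>r = 0\<close> the truncated bound \<open>r - 1\<close> is 0,
          and the first two cases suffice.\<close>
        have "i > r \<or> i = r \<or> i = r - 1 \<and> r > 0"
          using that by arith
        then consider "i > r" | "i = r" | "i = r - 1" "r > 0"
          by blast
        then show ?thesis
          using bd[of i] pred le[of i] r1 by cases (auto simp: m'_def lookup_minus)
      qed
      ultimately have "m' \<in> ?B (r - 1) (j - Suc r)"
        by (simp add: bounded_standard_monomials_def standard_monomials_def)
      with eq show ?thesis by (rule image_eqI)
    qed
    moreover have "ymon r + m \<in> ?T" if m: "m \<in> ?B (r - 1) (j - Suc r)" for m
    proof -
      have std: "standard m" and bd: "\<And>i. i \<ge> r - 1 \<Longrightarrow> Poly_Mapping.lookup m i = 0"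
        and w: "weight m = j - Suc r"
        using m by (auto simp: bounded_standard_monomials_def standard_monomials_def)
      have "Poly_Mapping.lookup (ymon r + m) i + Poly_Mapping.lookup (ymon r + m) (Suc i) \<le> 1" for i
        using std[unfolded standard_def, rule_format, of i] bd[of i] bd[of "Suc i"]
        by (auto simp: lookup_add lookup_single when_def)
      moreover have "weight (ymon r + m) = j"
        using w True by (simp add: weight_eq weighted_degree_add)
      ultimately show ?thesis
        using bd by (auto simp: bounded_standard_monomials_def standard_monomials_def standard_def
            lookup_add lookup_single when_def)
    qed
    ultimately have "?T = (\<lambda>m. ymon r + m) ` ?B (r - 1) (j - Suc r)"
      by blast
    with True show ?thesis
      by (simp only: if_True)
  next
    case False
    have "Poly_Mapping.lookup m r = 0" if "weight m = j" for m
      using weight_ge_lookup[of r m] that False by (cases "Poly_Mapping.lookup m r") auto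
    with False show ?thesis
      by (auto simp: bounded_standard_monomials_def standard_monomials_def)
  qed
  have "card ?T = (if Suc r \<le> j then card (?B (r - 1) (j - Suc r)) else 0)"
    unfolding T by (simp add: card_image inj_on_def)
  moreover have "card (?B r j \<union> ?T) = card (?B r j) + card ?T"
    using fin disj by (intro card_Un_disjoint) auto
  ultimately show ?thesis
    using arg_cong[OF split, of card] by linarith
qed

theorem corollary5p9:
  fixes A :: "nat \<Rightarrow> 'a::field_char_0 fps"
  assumes "A 1 = 1" and "A 2 = 1"
    and "\<And>d. d \<ge> 3 \<Longrightarrow> A d = A (d - 1) + fps_X ^ (d - 2) * A (d - 2)"
  shows "convergent A \<and>
    hilbert_poincare (arc_scale :: 'a \<Rightarrow> 'a arc_algebra \<Rightarrow> 'a arc_algebra) arc_piece = lim A"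
proof -
  let ?H = "hilbert_poincare (arc_scale :: 'a \<Rightarrow> 'a arc_algebra \<Rightarrow> 'a arc_algebra) arc_piece"
  \<comment> \<open>Truncation makes \<open>d - 2\<close> zero for \<open>d = 1\<close> as well, so
    both initial values count the monomials in no variables.\<close>
  have A: "fps_nth (A d) j = of_nat (card (bounded_standard_monomials (d - 2) j))"
    if "d \<ge> 1" for d j
    using that
  proof (induction d arbitrary: j rule: less_induct)
    case (less d)
    show ?case
    proof (cases "d \<ge> 3")
      case False
      with less.prems have "d = 1 \<or> d = 2"
        by arith
      then have "A d = 1" "d - 2 = 0"
        using assms(1,2) by auto
      then show ?thesis
        by (simp add: bounded_standard_monomials_0)
    next
      case True
      then obtain r where d: "d = r + 3"
        using that[of "d - 3"] by simp
      have IH1: "fps_nth (A (r + 2)) i = of_nat (card (bounded_standard_monomials r i))" for i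
        using less.IH[of "r + 2"] d by simp
      \<comment> \<open>Under truncated subtraction \<open>r + 1 - 2\<close> is \<open>r - 1\<close>
        even for \<open>r = 0\<close>, in agreement with the counting recurrence.\<close>
      have IH2: "fps_nth (A (r + 1)) i = of_nat (card (bounded_standard_monomials (r - 1) i))" for i
        using less.IH[of "r + 1"] d by simp
      have "A d = A (r + 2) + fps_X ^ Suc r * A (r + 1)"
        using assms(3)[OF True] by (simp add: d)
      then show ?thesis
        by (simp add: fps_X_power_mult_nth IH1[simplified] IH2[simplified] d card_bounded_standard_monomials_Suc del: power_Suc)
    qed
  qed
  \<comment> \<open>Convergence means that each coefficient is eventually constant; that of t^j is
    stable from \<open>d = j + 2\<close> on.\<close>
  have "A \<longlonglongrightarrow> ?H"
  proof (rule tendsto_fpsI)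
    fix j
    have "fps_nth (A d) j = fps_nth ?H j" if "d \<ge> j + 2" for d
      using that by (simp add: A hilbert_poincare_def dim_arc_piece bounded_standard_monomials_eq)
    then show "\<forall>\<^sub>F d in sequentially. fps_nth (A d) j = fps_nth ?H j"
      by (auto simp: eventually_sequentially)
  qed
  then show ?thesis
    by (auto simp: convergent_def limI)
qed

end
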